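(* Let $v:\mathbb{R}^2\to\mathbb{R}^2$ be a bounded shear flow solving the stationary incompressible Euler equations (with some pressure) in $\mathbb{R}^2$ and satisfying $\inf_{\mathbb{R}^2}|v|>0$. Then there is $\varepsilon>0$ such that, if $v'$ is a $C^2(\mathbb{R}^2)$ flow solving the stationary incompressible Euler equations (with some pressure) in $\mathbb{R}^2$ and satisfying $\|v'-v\|_{L^\infty(\mathbb{R}^2)}\le\varepsilon$, then $v'$ is a shear flow.
   Context: A vector field $w:\mathbb{R}^2\to\mathbb{R}^2$ solves the stationary incompressible Euler equations with pressure $p:\mathbb{R}^2\to\mathbb{R}$ if $w\cdot\nabla w+\nabla p=0$ and $\operatorname{div} w=0$ in $\mathbb{R}^2$; solutions are understood in the classical sense, i.e. $w$ and $p$ are at least of class $C^1(\mathbb{R}^2)$. A flow $w$ is a shear flow if there is a unit vector $e=(e_1,e_2)\in\mathbb{R}^2$ such that $w$ is parallel to $e$ everywhere; for a divergence-free flow this means that $w(x)=V(x\cdot e^\perp)\,e$ for all $x\in\mathbb{R}^2$ and some function $V:\mathbb{R}\to\mathbb{R}$, with $e^\perp=(-e_2,e_1)$. *)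

theory Defs
  imports "HOL-Analysis.Analysis" "HOL-Probability.Essential_Supremum"
begin

definition partial_deriv ::
    "'n \<Rightarrow> (real ^ 'n \<Rightarrow> 'b::real_normed_vector) \<Rightarrow> real ^ 'n \<Rightarrow> 'b" where
  "partial_deriv i f x = frechet_derivative f (at x) (axis i 1)"

text \<open>The class \<open>C\<^sup>k\<close> on the whole space. Differentiability is a separate conjunct because
  \<^const>\<open>frechet_derivative\<close> is unspecified where the derivative does not exist. No bound on the
  derivatives is imposed.\<close>

primrec C_class :: "nat \<Rightarrow> (real ^ 'n \<Rightarrow> 'b::real_normed_vector) \<Rightarrow> bool" where
  "C_class 0 f \<longleftrightarrow> continuous_on UNIV f"
| "C_class (Suc k) f \<longleftrightarrow>
     (\<forall>x. f differentiable (at x)) \<and> (\<forall>i. C_class k (partial_deriv i f))"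

definition gradient :: "(real ^ 'n \<Rightarrow> real) \<Rightarrow> real ^ 'n \<Rightarrow> real ^ 'n" where
  "gradient p x = (\<chi> i. partial_deriv i p x)"

definition divergence :: "(real ^ 'n \<Rightarrow> real ^ 'n) \<Rightarrow> real ^ 'n \<Rightarrow> real" where
  "divergence w x = (\<Sum>i\<in>UNIV. partial_deriv i w x $ i)"

definition convective :: "(real ^ 'n \<Rightarrow> real ^ 'n) \<Rightarrow> real ^ 'n \<Rightarrow> real ^ 'n" where
  "convective w x = (\<Sum>j\<in>UNIV. w x $ j *\<^sub>R partial_deriv j w x)"

definition stationary_euler :: "(real ^ 2 \<Rightarrow> real ^ 2) \<Rightarrow> (real ^ 2 \<Rightarrow> real) \<Rightarrow> bool" where
  "stationary_euler w p \<longleftrightarrow>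
     C_class 1 w \<and> C_class 1 p \<and>
     (\<forall>x. convective w x + gradient p x = 0) \<and>
     (\<forall>x. divergence w x = 0)"

text \<open>The zero vector counts as parallel to every direction, so a shear flow may have stagnation
  points.\<close>

definition shear_flow :: "(real ^ 2 \<Rightarrow> real ^ 2) \<Rightarrow> bool" where
  "shear_flow w \<longleftrightarrow> (\<exists>e. norm e = 1 \<and> (\<forall>x. \<exists>c. w x = c *\<^sub>R e))"

text \<open>The norm is extended-real valued: it is \<open>\<infinity>\<close> for essentially unbounded fields.\<close>

definition Linf_norm :: "(real ^ 2 \<Rightarrow> real ^ 2) \<Rightarrow> ereal" where
  "Linf_norm f = esssup lebesgue (\<lambda>x. ereal (norm (f x)))"

end

theory Submission
  imports Defs
begin

text \<open>
  Let \<open>e\<close> be the direction of the shear flow \<open>v\<close>, let \<open>n\<close> be the unit vector orthogonal to \<open>e\<close>,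
  and let \<open>m > 0\<close> be the infimum of the speed. A field \<open>v'\<close> within \<open>m / 2\<close> of \<open>v\<close> has
  \<open>\<phi> = v' \<bullet> e\<close> nowhere zero, because \<open>\<bar>v \<bullet> e\<bar> = \<bar>v\<bar> \<ge> m\<close>, and
  \<open>\<psi> = v' \<bullet> n\<close> bounded, because \<open>v \<bullet> n = 0\<close>. It therefore suffices to show that such
  an Euler flow is a shear flow (\<open>euler_flow_is_shear\<close>), that is, that the slope
  \<open>\<sigma> = \<psi> / \<phi>\<close> of its velocity is constant.

  The slope solves a linear elliptic equation in divergence form:
  \<open>div (\<phi>\<^sup>2 \<nabla>\<sigma>) = div (\<phi> \<nabla>\<psi> - \<psi> \<nabla>\<phi>) = \<phi> \<Delta>\<psi> - \<psi> \<Delta>\<phi>\<close>.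
  For a divergence-free field, \<open>\<Delta>v'\<close> is the vorticity gradient turned by a right angle, so the
  right-hand side is the derivative of the vorticity along \<open>v'\<close>, and this vanishes: it is the curl of
  the Euler equation (\<open>vorticity_transport\<close>). The momentum equation makes \<open>\<nabla>p\<close> of class \<open>C\<^sup>1\<close>
  although \<open>p\<close> is only assumed to be \<open>C\<^sup>1\<close>, so the mixed derivatives of \<open>p\<close> agree
  (\<open>mixed_partials_eq\<close>) and \<open>p\<close> drops out.

  The weight satisfies \<open>\<phi>\<^sup>2 \<sigma>\<^sup>2 = \<psi>\<^sup>2\<close>, which is bounded. In the plane this alone is enough for a Liouville theorem of
  Berestycki, Caffarelli and Nirenberg (\<open>liouville_weighted\<close>). Testing the equation with
  \<open>\<zeta>\<^sup>2 \<sigma>\<close>, where \<open>\<zeta>\<close> is a cutoff at scale \<open>R\<close>, bounds the weighted energy of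
  \<open>\<nabla>\<sigma>\<close> by a multiple of \<open>\<integral> \<psi>\<^sup>2 \<bar>\<nabla>\<zeta>\<bar>\<^sup>2\<close>. In dimension two the
  factor \<open>1 / R\<^sup>2\<close> from \<open>\<bar>\<nabla>\<zeta>\<bar>\<^sup>2\<close> balances the area, so the bound does not depend on
  \<open>R\<close> and the total energy is finite. The energy in the annuli carrying \<open>\<nabla>\<zeta>\<close> then tends to
  zero, and this in turn forces the total energy to be zero.
\<close>

section \<open>Cutoff functions and the divergence theorem on squares\<close>

lemma DERIV_positive_part_squared:
  "((\<lambda>t::real. (max 0 t)\<^sup>2) has_real_derivative 2 * max 0 t) (at t)"
proof -
  consider "t > 0" | "t < 0" | "t = 0" by linarith
  then show ?thesis
  proof cases
    case 1
    have "((\<lambda>t. t\<^sup>2) has_real_derivative 2 * max 0 t) (at t)"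
      using 1 by (auto intro!: derivative_eq_intros)
    then show ?thesis
      by (rule has_field_derivative_transform_within_open[of _ _ _ "{0<..}"]) (use 1 in auto)
  next
    case 2
    have "((\<lambda>t. 0) has_real_derivative 2 * max 0 t) (at t)"
      using 2 by (auto intro!: derivative_eq_intros)
    then show ?thesis
      by (rule has_field_derivative_transform_within_open[of _ _ _ "{..<0}"]) (use 2 in auto)
  next
    case 3
    have "((\<lambda>y::real. max 0 y) \<longlongrightarrow> max 0 0) (at 0)"
      by (intro tendsto_intros)
    moreover have "(max 0 y)\<^sup>2 / y = max 0 y" for y :: real
      by (auto simp: max_def power2_eq_square)
    ultimately show ?thesis
      using 3 by (simp add: has_field_derivative_iff)
  qed
qed

text \<open>The cutoff is \<open>((1 - d\<^sup>2)\<^sub>+)\<^sup>2\<close>, where \<open>d\<close> is the distance of \<open>t\<close> to \<open>[-1, 1]\<close>. The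
  squares of positive parts make it continuously differentiable across the points \<open>\<plusminus>1\<close> and
  \<open>\<plusminus>2\<close>.\<close>

lemma C1_cutoff:
  obtains h h' :: "real \<Rightarrow> real"
  where "\<And>t. (h has_real_derivative h' t) (at t)" "continuous_on UNIV h'"
    "\<And>t. 0 \<le> h t" "\<And>t. h t \<le> 1"
    "\<And>t. \<bar>t\<bar> \<le> 1 \<Longrightarrow> h t = 1" "\<And>t. \<bar>t\<bar> \<le> 1 \<Longrightarrow> h' t = 0"
    "\<And>t. 2 \<le> \<bar>t\<bar> \<Longrightarrow> h t = 0" "\<And>t. \<bar>h' t\<bar> \<le> 4"
proof -
  define u where "u t = 1 - (max 0 (t - 1))\<^sup>2 - (max 0 (- t - 1))\<^sup>2" for t :: real
  define u' where "u' t = 2 * max 0 (- t - 1) - 2 * max 0 (t - 1)" for t :: real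
  define h where "h t = (max 0 (u t))\<^sup>2" for t
  define h' where "h' t = 2 * max 0 (u t) * u' t" for t
  have u: "(u has_real_derivative u' t) (at t)" for t
  proof -
    have "((\<lambda>t. (max 0 (t - 1))\<^sup>2) has_real_derivative 2 * max 0 (t - 1) * 1) (at t)"
      by (rule DERIV_chain2[OF DERIV_positive_part_squared]) (auto intro!: derivative_eq_intros)
    moreover have "((\<lambda>t. (max 0 (- t - 1))\<^sup>2) has_real_derivative 2 * max 0 (- t - 1) * - 1) (at t)"
      by (rule DERIV_chain2[OF DERIV_positive_part_squared]) (auto intro!: derivative_eq_intros)
    ultimately show ?thesis
      unfolding u_def u'_def by (rule DERIV_cong[OF DERIV_diff[OF DERIV_diff[OF DERIV_const]]]) simp
  qed
  have h: "(h has_real_derivative h' t) (at t)" for t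
    unfolding h_def h'_def by (rule DERIV_chain2[OF DERIV_positive_part_squared u])
  have cont: "continuous_on UNIV h'"
    unfolding h'_def u'_def u_def by (intro continuous_intros)
  have u1: "u t \<le> 1" for t by (simp add: u_def)
  have u0: "u t \<le> 0" if "2 \<le> \<bar>t\<bar>" for t
  proof -
    have "1 \<le> max 0 (t - 1) \<or> 1 \<le> max 0 (- t - 1)" using that by linarith
    then have "1 \<le> (max 0 (t - 1))\<^sup>2 \<or> 1 \<le> (max 0 (- t - 1))\<^sup>2"
      by (metis one_le_power)
    moreover have "0 \<le> (max 0 (t - 1))\<^sup>2" "0 \<le> (max 0 (- t - 1))\<^sup>2" by auto
    ultimately show ?thesis unfolding u_def by linarith
  qed
  have b: "\<bar>h' t\<bar> \<le> 4" for t
  proof (cases "2 \<le> \<bar>t\<bar>")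
    case True
    then show ?thesis using u0[of t] by (simp add: h'_def)
  next
    case False
    then have "\<bar>u' t\<bar> \<le> 2" unfolding u'_def by (simp add: max_def abs_if split: if_splits)
    moreover have "\<bar>2 * max 0 (u t)\<bar> \<le> 2" using u1[of t] by auto
    ultimately show ?thesis
      unfolding h'_def using mult_mono[of "\<bar>2 * max 0 (u t)\<bar>" 2 "\<bar>u' t\<bar>" 2]
      by (simp add: abs_mult)
  qed
  show thesis
  proof (rule that[of h h'])
    show "h t \<le> 1" for t
      unfolding h_def using u1[of t] by (intro power_le_one) auto
    show "h t = 1" if "\<bar>t\<bar> \<le> 1" for t
      using that by (auto simp: h_def u_def max_def)
    show "h' t = 0" if "\<bar>t\<bar> \<le> 1" for t
      using that by (auto simp: h'_def u'_def max_def)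
    show "h t = 0" if "2 \<le> \<bar>t\<bar>" for t
      using u0[OF that] by (simp add: h_def)
  qed (use h cont b in \<open>auto simp: h_def\<close>)
qed

text \<open>Fubini's theorem lets each term be integrated first in its own variable, where the fundamental
  theorem of calculus leaves only boundary values.\<close>

lemma integral_divergence_eq_0:
  fixes G1 G2 d1 d2 :: "real \<times> real \<Rightarrow> real"
  assumes A: "0 \<le> A"
    and d1: "\<And>x y. ((\<lambda>t. G1 (t, y)) has_real_derivative d1 (x, y)) (at x)"
    and d2: "\<And>x y. ((\<lambda>t. G2 (x, t)) has_real_derivative d2 (x, y)) (at y)"
    and c1: "continuous_on UNIV d1" and c2: "continuous_on UNIV d2"
    and z1: "\<And>x y. \<bar>x\<bar> = A \<Longrightarrow> G1 (x, y) = 0"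
    and z2: "\<And>x y. \<bar>y\<bar> = A \<Longrightarrow> G2 (x, y) = 0"
  shows "integral (cbox (-A, -A) (A, A)) (\<lambda>z. d1 z + d2 z) = 0"
proof -
  let ?Q = "cbox (-A, -A) (A, A) :: (real \<times> real) set"
  have c1': "continuous_on ?Q d1" and c2': "continuous_on ?Q d2"
    using c1 c2 continuous_on_subset by blast+
  have 1: "((\<lambda>x. d1 (x, y)) has_integral (G1 (A, y) - G1 (-A, y))) {-A..A}" for y
    using A by (intro fundamental_theorem_of_calculus)
      (auto intro!: has_field_derivative_at_within d1 simp flip: has_real_derivative_iff_has_vector_derivative)
  have 2: "((\<lambda>y. d2 (x, y)) has_integral (G2 (x, A) - G2 (x, -A))) {-A..A}" for x
    using A by (intro fundamental_theorem_of_calculus)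
      (auto intro!: has_field_derivative_at_within d2 simp flip: has_real_derivative_iff_has_vector_derivative)
  have i1: "integral {-A..A} (\<lambda>x. d1 (x, y)) = 0" for y
    using integral_unique[OF 1] A by (simp add: z1)
  have i2: "integral {-A..A} (\<lambda>y. d2 (x, y)) = 0" for x
    using integral_unique[OF 2] A by (simp add: z2)
  have "integral ?Q d1 = integral (cbox (-A) A) (\<lambda>x. integral (cbox (-A) A) (\<lambda>y. d1 (x, y)))"
    using integral_prod_continuous[of "-A" "-A" A A d1] c1' by simp
  also have "\<dots> = integral (cbox (-A) A) (\<lambda>y. integral (cbox (-A) A) (\<lambda>x. d1 (x, y)))"
    using integral_swap_continuous[of "-A" "-A" A A "\<lambda>x y. d1 (x, y)"] c1' by simp
  finally have 3: "integral ?Q d1 = 0" by (simp add: i1)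
  have 4: "integral ?Q d2 = 0"
    using integral_prod_continuous[of "-A" "-A" A A d2] c2' by (simp add: i2)
  show ?thesis
    using 3 4 integral_add[OF integrable_continuous[OF c1'] integrable_continuous[OF c2']] by simp
qed

section \<open>A Liouville theorem for degenerate elliptic equations in the plane\<close>

text \<open>The equation \<open>div (w \<nabla>s) = 0\<close> forces \<open>\<nabla>s\<close> to vanish where the weight is positive,
  provided that \<open>w s\<^sup>2\<close> is bounded. With \<open>D = w \<bar>\<nabla>s\<bar>\<^sup>2\<close> and \<open>E n\<close> the integral of
  \<open>\<zeta>\<^sub>n\<^sup>2 D\<close> for the cutoff \<open>\<zeta>\<^sub>n\<close> at scale \<open>2\<^sup>n\<close>, the core of the proof is
  \<open>E (n + 1) \<le> \<delta> (E (n + 1) - E n) + C / \<delta>\<close> for all \<open>\<delta> > 0\<close>. The choice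
  \<open>\<delta> = 1/2\<close> bounds the increasing sequence \<open>E\<close>. Its limit is then at most \<open>C / \<delta>\<close> for
  every \<open>\<delta>\<close>, hence zero.\<close>

lemma liouville_weighted:
  fixes s s1 s2 w d1 d2 :: "real \<times> real \<Rightarrow> real"
  assumes s1: "\<And>x y. ((\<lambda>t. s (t, y)) has_real_derivative s1 (x, y)) (at x)"
    and s2: "\<And>x y. ((\<lambda>t. s (x, t)) has_real_derivative s2 (x, y)) (at y)"
    and d1: "\<And>x y. ((\<lambda>t. w (t, y) * s1 (t, y)) has_real_derivative d1 (x, y)) (at x)"
    and d2: "\<And>x y. ((\<lambda>t. w (x, t) * s2 (x, t)) has_real_derivative d2 (x, y)) (at y)"
    and cont: "continuous_on UNIV s" "continuous_on UNIV s1" "continuous_on UNIV s2"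
      "continuous_on UNIV w" "continuous_on UNIV d1" "continuous_on UNIV d2"
    and div0: "\<And>z. d1 z + d2 z = 0"
    and w0: "\<And>z. 0 \<le> w z"
    and bound: "\<And>z. w z * (s z)\<^sup>2 \<le> K"
  shows "w z * ((s1 z)\<^sup>2 + (s2 z)\<^sup>2) = 0"
proof -
  obtain h h' :: "real \<Rightarrow> real"
    where h: "\<And>t. (h has_real_derivative h' t) (at t)" and ch': "continuous_on UNIV h'"
      and h0: "\<And>t. 0 \<le> h t" and h1: "\<And>t. h t \<le> 1"
      and h_in: "\<And>t. \<bar>t\<bar> \<le> 1 \<Longrightarrow> h t = 1" "\<And>t. \<bar>t\<bar> \<le> 1 \<Longrightarrow> h' t = 0"
      and h_out: "\<And>t. 2 \<le> \<bar>t\<bar> \<Longrightarrow> h t = 0" and h'4: "\<And>t. \<bar>h' t\<bar> \<le> 4"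
    using C1_cutoff by blast
  have ch: "continuous_on UNIV h"
    using h by (meson DERIV_isCont continuous_at_imp_continuous_on)
  define r where "r n = (2::real) ^ n" for n :: nat
  define \<zeta> where "\<zeta> n z = h (fst z / r n) * h (snd z / r n)" for n z
  define \<zeta>1 where "\<zeta>1 n z = h' (fst z / r n) / r n * h (snd z / r n)" for n z
  define \<zeta>2 where "\<zeta>2 n z = h (fst z / r n) * (h' (snd z / r n) / r n)" for n z
  define D where "D z = w z * ((s1 z)\<^sup>2 + (s2 z)\<^sup>2)" for z
  define Q where "Q n = cbox (- (2 * r n), - (2 * r n)) (2 * r n, 2 * r n)" for n
  define E where "E n = integral (Q n) (\<lambda>z. (\<zeta> n z)\<^sup>2 * D z)" for n
  define I where "I n = integral (Q (Suc n)) (\<lambda>z. (\<zeta> n z)\<^sup>2 * D z)" for n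
  have r: "0 < r n" "r (Suc n) = 2 * r n" for n by (auto simp: r_def)
  have ch2: "continuous_on UNIV (\<lambda>z. h (f z))" "continuous_on UNIV (\<lambda>z. h' (f z))"
    if "continuous_on UNIV f" for f :: "real \<times> real \<Rightarrow> real"
    using that ch ch' by (auto intro: continuous_on_compose2)
  have c\<zeta>: "continuous_on UNIV (\<zeta> n)" "continuous_on UNIV (\<zeta>1 n)" "continuous_on UNIV (\<zeta>2 n)" for n
    using less_imp_neq[OF r(1)[of n]]
    unfolding \<zeta>_def \<zeta>1_def \<zeta>2_def by (auto intro!: continuous_intros ch2)
  have cD: "continuous_on UNIV D"
    unfolding D_def by (intro continuous_intros cont)
  have int: "f integrable_on Q n" if "continuous_on UNIV f" for f :: "real \<times> real \<Rightarrow> real" and n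
    unfolding Q_def using that continuous_on_subset by (blast intro: integrable_continuous)
  have D0: "0 \<le> D z" for z using w0 by (simp add: D_def)
  have ci: "(\<lambda>z. (\<zeta> n z)\<^sup>2 * D z) integrable_on Q m" for n m
    by (intro int continuous_intros c\<zeta> cD)
  have \<zeta>0: "0 \<le> \<zeta> n z" and \<zeta>le1: "\<zeta> n z \<le> 1" for n z
    using h0 h1 by (auto simp: \<zeta>_def intro: mult_le_one)
  have h'z: "h' t = 0" if "h (2 * t) \<noteq> 0" for t
    using that h_out[of "2 * t"] h_in(2)[of t] by force
  have h1': "h t = 1" if "h (2 * t) \<noteq> 0" for t
    using that h_out[of "2 * t"] h_in(1)[of t] by force
  have twice: "t / r n = 2 * (t / r (Suc n))" for t n using r[of n] by simp
  \<comment> \<open>Dyadic scales nest the cutoffs: the next one is already constant on the support of the previous one.\<close>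
  have inner: "\<zeta> (Suc n) z = 1" "\<zeta>1 (Suc n) z = 0" "\<zeta>2 (Suc n) z = 0" if "\<zeta> n z \<noteq> 0" for n z
  proof -
    have "h (2 * (fst z / r (Suc n))) \<noteq> 0" "h (2 * (snd z / r (Suc n))) \<noteq> 0"
      using that unfolding \<zeta>_def twice[of _ n] by auto
    then show "\<zeta> (Suc n) z = 1" "\<zeta>1 (Suc n) z = 0" "\<zeta>2 (Suc n) z = 0"
      using h'z h1' by (simp_all add: \<zeta>_def \<zeta>1_def \<zeta>2_def)
  qed
  have grad\<zeta>: "(\<zeta>1 n z)\<^sup>2 \<le> 16 / (r n)\<^sup>2" "(\<zeta>2 n z)\<^sup>2 \<le> 16 / (r n)\<^sup>2" for n z
  proof -
    have *: "(h' a / r n * h b)\<^sup>2 \<le> 16 / (r n)\<^sup>2" for a b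
    proof -
      have "(h' a)\<^sup>2 \<le> 4\<^sup>2" using h'4[of a] by (intro abs_le_square_iff[THEN iffD1]) auto
      moreover have "(h b)\<^sup>2 \<le> 1" using h0 h1 by (simp add: power_le_one)
      ultimately have "(h' a)\<^sup>2 * (h b)\<^sup>2 \<le> 4\<^sup>2 * 1" by (intro mult_mono) auto
      then show ?thesis
        by (simp add: power_mult_distrib power_divide divide_right_mono)
    qed
    show "(\<zeta>1 n z)\<^sup>2 \<le> 16 / (r n)\<^sup>2" "(\<zeta>2 n z)\<^sup>2 \<le> 16 / (r n)\<^sup>2"
      using * unfolding \<zeta>1_def \<zeta>2_def by (auto simp: mult.commute)
  qed
  have dh: "((\<lambda>t. h (t / r n)) has_real_derivative h' (x / r n) / r n) (at x)" for n x
  proof -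
    have "((\<lambda>t. h (t / r n)) has_real_derivative h' (x / r n) * (1 / r n)) (at x)"
      by (rule DERIV_chain2[OF h]) (use r(1)[of n] in \<open>auto intro!: derivative_eq_intros\<close>)
    then show ?thesis by simp
  qed
  have d\<zeta>1: "((\<lambda>t. \<zeta> n (t, y)) has_real_derivative \<zeta>1 n (x, y)) (at x)" for n x y
    unfolding \<zeta>_def \<zeta>1_def by (auto intro!: derivative_eq_intros dh)
  have d\<zeta>2: "((\<lambda>t. \<zeta> n (x, t)) has_real_derivative \<zeta>2 n (x, y)) (at y)" for n x y
    unfolding \<zeta>_def \<zeta>2_def by (auto intro!: derivative_eq_intros dh)
  \<comment> \<open>The equation tested with \<open>\<zeta>\<^sup>2 s\<close>: the divergence of \<open>\<zeta>\<^sup>2 s w \<nabla>s\<close> integrates to zero.\<close>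
  have E_eq: "E n = integral (Q n) (\<lambda>z. - 2 * \<zeta> n z * s z * w z * (\<zeta>1 n z * s1 z + \<zeta>2 n z * s2 z))" for n
  proof -
    define g1 where "g1 z = 2 * \<zeta> n z * \<zeta>1 n z * s z * (w z * s1 z) + (\<zeta> n z)\<^sup>2 * s1 z * (w z * s1 z)
      + (\<zeta> n z)\<^sup>2 * s z * d1 z" for z
    define g2 where "g2 z = 2 * \<zeta> n z * \<zeta>2 n z * s z * (w z * s2 z) + (\<zeta> n z)\<^sup>2 * s2 z * (w z * s2 z)
      + (\<zeta> n z)\<^sup>2 * s z * d2 z" for z
    have sq1: "((\<lambda>t. (\<zeta> n (t, y))\<^sup>2) has_real_derivative 2 * \<zeta> n (x, y) * \<zeta>1 n (x, y)) (at x)" for x y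
      by (auto intro!: derivative_eq_intros d\<zeta>1)
    have sq2: "((\<lambda>t. (\<zeta> n (x, t))\<^sup>2) has_real_derivative 2 * \<zeta> n (x, y) * \<zeta>2 n (x, y)) (at y)" for x y
      by (auto intro!: derivative_eq_intros d\<zeta>2)
    have "integral (Q n) (\<lambda>z. g1 z + g2 z) = 0"
      unfolding Q_def
    proof (rule integral_divergence_eq_0[where ?G1.0 = "\<lambda>z. (\<zeta> n z)\<^sup>2 * s z * (w z * s1 z)"
        and ?G2.0 = "\<lambda>z. (\<zeta> n z)\<^sup>2 * s z * (w z * s2 z)"])
      show "((\<lambda>t. (\<zeta> n (t, y))\<^sup>2 * s (t, y) * (w (t, y) * s1 (t, y))) has_real_derivative g1 (x, y)) (at x)" for x y
        unfolding g1_def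
        by (rule DERIV_cong[OF DERIV_mult[OF DERIV_mult[OF sq1 s1] d1]]) (simp add: algebra_simps)
      show "((\<lambda>t. (\<zeta> n (x, t))\<^sup>2 * s (x, t) * (w (x, t) * s2 (x, t))) has_real_derivative g2 (x, y)) (at y)" for x y
        unfolding g2_def
        by (rule DERIV_cong[OF DERIV_mult[OF DERIV_mult[OF sq2 s2] d2]]) (simp add: algebra_simps)
      show "continuous_on UNIV g1" "continuous_on UNIV g2"
        unfolding g1_def g2_def by (intro continuous_intros cont c\<zeta>)+
      have vanish: "\<zeta> n (x, y) = 0" if "\<bar>x\<bar> = 2 * r n \<or> \<bar>y\<bar> = 2 * r n" for x y
        using that h_out[of "x / r n"] h_out[of "y / r n"] r[of n] by (auto simp: \<zeta>_def abs_divide)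
      show "(\<zeta> n (x, y))\<^sup>2 * s (x, y) * (w (x, y) * s1 (x, y)) = 0" if "\<bar>x\<bar> = 2 * r n" for x y
        using that vanish by simp
      show "(\<zeta> n (x, y))\<^sup>2 * s (x, y) * (w (x, y) * s2 (x, y)) = 0" if "\<bar>y\<bar> = 2 * r n" for x y
        using that vanish by simp
    qed (use r[of n] in simp)
    moreover have "g1 z + g2 z = (\<zeta> n z)\<^sup>2 * D z
        - (- 2 * \<zeta> n z * s z * w z * (\<zeta>1 n z * s1 z + \<zeta>2 n z * s2 z))" for z
    proof -
      have "g1 z + g2 z = (\<zeta> n z)\<^sup>2 * D z
        - (- 2 * \<zeta> n z * s z * w z * (\<zeta>1 n z * s1 z + \<zeta>2 n z * s2 z)) + (\<zeta> n z)\<^sup>2 * s z * (d1 z + d2 z)"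
        unfolding g1_def g2_def D_def by (simp add: algebra_simps power2_eq_square)
      then show ?thesis by (simp add: div0)
    qed
    ultimately have "integral (Q n) (\<lambda>z. (\<zeta> n z)\<^sup>2 * D z
        - (- 2 * \<zeta> n z * s z * w z * (\<zeta>1 n z * s1 z + \<zeta>2 n z * s2 z))) = 0"
      by simp
    moreover have "(\<lambda>z. - 2 * \<zeta> n z * s z * w z * (\<zeta>1 n z * s1 z + \<zeta>2 n z * s2 z)) integrable_on Q n"
      by (intro int continuous_intros c\<zeta> cont)
    note integral_diff[OF ci[of n n] this]
    ultimately show ?thesis
      unfolding E_def by linarith
  qed
  have K0: "0 \<le> K"
    using bound[of z] w0[of z] by (meson mult_nonneg_nonneg order_trans zero_le_power2)
  \<comment> \<open>Young's inequality with weight \<open>\<delta>\<close>. By \<open>inner\<close>, the left-hand side lives where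
      \<open>\<zeta> n\<close> vanishes, so that the energy term can be charged to the annulus alone.\<close>
  have pointwise: "- 2 * \<zeta> (Suc n) z * s z * w z * (\<zeta>1 (Suc n) z * s1 z + \<zeta>2 (Suc n) z * s2 z)
      \<le> \<delta> * ((\<zeta> (Suc n) z)\<^sup>2 * D z - (\<zeta> n z)\<^sup>2 * D z) + 32 * K / (\<delta> * (r (Suc n))\<^sup>2)"
    if \<delta>: "0 < \<delta>" for n z \<delta>
  proof (cases "\<zeta> n z = 0")
    case False
    have "(\<zeta> n z)\<^sup>2 * D z \<le> 1 * D z"
      using \<zeta>0 \<zeta>le1 D0 by (intro mult_right_mono) (auto simp: power_le_one)
    then show ?thesis
      using inner[OF False] \<delta> K0 by simp
  next
    case True
    have young: "- 2 * a * b \<le> \<delta> * a\<^sup>2 + b\<^sup>2 / \<delta>" for a b :: real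
    proof -
      have "\<delta> * a\<^sup>2 + b\<^sup>2 / \<delta> + 2 * a * b = (\<delta> * a + b)\<^sup>2 / \<delta>"
        using \<delta> by (simp add: power2_eq_square field_simps)
      moreover have "0 \<le> (\<delta> * a + b)\<^sup>2 / \<delta>" using \<delta> by simp
      ultimately show ?thesis by linarith
    qed
    let ?\<zeta> = "\<zeta> (Suc n) z" and ?a = "\<zeta>1 (Suc n) z" and ?b = "\<zeta>2 (Suc n) z"
    have "- 2 * (?\<zeta> * s1 z) * (s z * ?a) + - 2 * (?\<zeta> * s2 z) * (s z * ?b)
        \<le> \<delta> * (?\<zeta> * s1 z)\<^sup>2 + (s z * ?a)\<^sup>2 / \<delta> + (\<delta> * (?\<zeta> * s2 z)\<^sup>2 + (s z * ?b)\<^sup>2 / \<delta>)"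
      by (intro add_mono young)
    from mult_left_mono[OF this w0[of z]]
    have "- 2 * ?\<zeta> * s z * w z * (?a * s1 z + ?b * s2 z)
        \<le> \<delta> * (?\<zeta>\<^sup>2 * D z) + (w z * (s z)\<^sup>2) * (?a\<^sup>2 + ?b\<^sup>2) / \<delta>"
      unfolding D_def by (simp add: algebra_simps power_mult_distrib add_divide_distrib)
    also have "(w z * (s z)\<^sup>2) * (?a\<^sup>2 + ?b\<^sup>2) \<le> K * (16 / (r (Suc n))\<^sup>2 + 16 / (r (Suc n))\<^sup>2)"
      using grad\<zeta> K0 bound by (intro mult_mono add_mono) auto
    finally show ?thesis using True \<delta> by (simp add: divide_right_mono field_simps)
  qed
  \<comment> \<open>The square \<open>Q (Suc n)\<close> has area \<open>16 r\<^sup>2\<close>, and \<open>32 \<cdot> 16 = 512\<close>: the scale cancels.\<close>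
  have energy: "E (Suc n) \<le> \<delta> * (E (Suc n) - I n) + 512 * K / \<delta>" if \<delta>: "0 < \<delta>" for n \<delta>
  proof -
    define c where "c = 32 * K / (\<delta> * (r (Suc n))\<^sup>2)"
    have "E (Suc n) \<le> integral (Q (Suc n))
       (\<lambda>z. \<delta> * ((\<zeta> (Suc n) z)\<^sup>2 * D z - (\<zeta> n z)\<^sup>2 * D z) + c)"
      unfolding E_eq c_def
      by (intro integral_le pointwise \<delta> int continuous_intros c\<zeta> cont cD)
    also have "\<dots> = \<delta> * (E (Suc n) - I n) + integral (Q (Suc n)) (\<lambda>z. c)"
      unfolding E_def I_def
      by (subst integral_add) (auto intro!: int continuous_intros c\<zeta> cD simp: integral_diff[OF ci ci])
    also have "integral (Q (Suc n)) (\<lambda>z. c) = c * (4 * r (Suc n))\<^sup>2"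
      using r(1)[of "Suc n"] by (simp add: Q_def content_Pair power2_eq_square)
    also have "c * (4 * r (Suc n))\<^sup>2 = 512 * K / \<delta>"
      using r(1)[of "Suc n"] \<delta> by (simp add: c_def power2_eq_square field_simps)
    finally show ?thesis .
  qed
  have EI: "E n \<le> I n" for n
    unfolding E_def I_def
    by (intro integral_subset_le ci) (use r[of n] D0 in \<open>auto simp: Q_def\<close>)
  have IE: "I n \<le> E (Suc n)" for n
    unfolding E_def I_def
  proof (intro integral_le ci mult_right_mono D0)
    show "(\<zeta> n z)\<^sup>2 \<le> (\<zeta> (Suc n) z)\<^sup>2" for z
      using inner[of n z] \<zeta>0[of n z] \<zeta>le1[of n z] by (cases "\<zeta> n z = 0") (auto simp: power_le_one)
  qed
  have E0: "0 \<le> E n" for n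
    unfolding E_def using D0 by (intro integral_nonneg ci) auto
  have inc: "incseq E" using EI IE by (intro incseq_SucI) (meson order_trans)
  have "E n \<le> 2048 * K" for n
    using energy[of "1/2" n] EI[of n] IE[of n] E0[of n] by (simp add: field_simps)
  then obtain L where L: "E \<longlonglongrightarrow> L"
    using incseq_convergent[OF inc] by blast
  have "L \<le> \<delta> * 0 + 512 * K / \<delta>" if "0 < \<delta>" for \<delta>
  proof (rule LIMSEQ_le[OF LIMSEQ_Suc[OF L]])
    show "(\<lambda>n. \<delta> * (E (Suc n) - E n) + 512 * K / \<delta>) \<longlonglongrightarrow> \<delta> * 0 + 512 * K / \<delta>"
      using tendsto_diff[OF LIMSEQ_Suc[OF L] L] by (intro tendsto_intros) auto
    have "E (Suc n) \<le> \<delta> * (E (Suc n) - E n) + 512 * K / \<delta>" for n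
    proof -
      have "\<delta> * (E (Suc n) - I n) \<le> \<delta> * (E (Suc n) - E n)"
        using that EI[of n] by (intro mult_left_mono) auto
      then show ?thesis using energy[OF that, of n] by linarith
    qed
    then show "\<exists>N. \<forall>n\<ge>N. E (Suc n) \<le> \<delta> * (E (Suc n) - E n) + 512 * K / \<delta>" by blast
  qed
  \<comment> \<open>A positive \<open>L\<close> is refuted by \<open>\<delta> = (512 K + 1) / L\<close>.\<close>
  then have "L * \<delta> \<le> 512 * K" if "0 < \<delta>" for \<delta>
    using that by (fastforce simp: field_simps)
  moreover have "L * ((512 * K + 1) / L) = 512 * K + 1" if "0 < L" using that by simp
  moreover have "0 < (512 * K + 1) / L" if "0 < L" using that K0 by simp
  ultimately have "L \<le> 0" by (smt (verit))
  then have E_eq0: "E n = 0" for n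
    using incseq_le[OF inc L, of n] E0[of n] by linarith
  obtain n where n: "max \<bar>fst z\<bar> \<bar>snd z\<bar> < r n"
    using real_arch_pow[of 2 "max \<bar>fst z\<bar> \<bar>snd z\<bar>"] unfolding r_def by auto
  have "(\<zeta> n z)\<^sup>2 * D z = 0"
  proof (rule has_integral_0_cbox_imp_0[where f = "\<lambda>z. (\<zeta> n z)\<^sup>2 * D z"])
    show "((\<lambda>z. (\<zeta> n z)\<^sup>2 * D z) has_integral 0) (cbox (- (2 * r n), - (2 * r n)) (2 * r n, 2 * r n))"
      using integrable_integral[OF ci, of n n] E_eq0[of n] by (simp add: E_def Q_def)
    show "continuous_on (cbox (- (2 * r n), - (2 * r n)) (2 * r n, 2 * r n)) (\<lambda>z. (\<zeta> n z)\<^sup>2 * D z)"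
      by (rule continuous_on_subset[of UNIV]) (auto intro!: continuous_intros c\<zeta> cD)
    show "z \<in> cbox (- (2 * r n), - (2 * r n)) (2 * r n, 2 * r n)"
      using n r[of n] by (cases z) auto
  qed (use D0 r[of n] in \<open>auto simp: Q_def box_ne_empty Basis_prod_def\<close>)
  moreover have "\<zeta> n z = 1"
    using n r[of n] by (auto simp: \<zeta>_def h_in(1) abs_divide)
  ultimately show ?thesis by (simp add: D_def)
qed

section \<open>Symmetry of mixed partial derivatives\<close>

text \<open>The second difference of \<open>f\<close> over a square, treated by the mean value theorem in one variable
  after the other. It is symmetric in the two variables, which gives the equality of mixed partial
  derivatives below.\<close>

lemma mixed_difference_mean_value:
  fixes f f1 f12 :: "real \<times> real \<Rightarrow> real"
  assumes f1: "\<And>x y. ((\<lambda>t. f (t, y)) has_real_derivative f1 (x, y)) (at x)"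
    and f12: "\<And>x y. ((\<lambda>t. f1 (x, t)) has_real_derivative f12 (x, y)) (at y)"
    and h: "0 < h"
  obtains x y where "a < x" "x < a + h" "b < y" "y < b + h"
    "f (a + h, b + h) - f (a + h, b) - f (a, b + h) + f (a, b) = h\<^sup>2 * f12 (x, y)"
proof -
  have "\<exists>x>a. x < a + h \<and> (f (a + h, b + h) - f (a + h, b)) - (f (a, b + h) - f (a, b))
      = (a + h - a) * (f1 (x, b + h) - f1 (x, b))"
    by (rule MVT2) (use h in \<open>auto intro!: DERIV_diff f1\<close>)
  then obtain x where x: "a < x" "x < a + h"
    "(f (a + h, b + h) - f (a + h, b)) - (f (a, b + h) - f (a, b)) = h * (f1 (x, b + h) - f1 (x, b))"
    by auto
  have "\<exists>y>b. y < b + h \<and> f1 (x, b + h) - f1 (x, b) = (b + h - b) * f12 (x, y)"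
    by (rule MVT2) (use h in \<open>auto intro!: f12\<close>)
  then obtain y where y: "b < y" "y < b + h" "f1 (x, b + h) - f1 (x, b) = h * f12 (x, y)"
    by auto
  show thesis
    by (rule that[OF x(1,2) y(1,2)]) (use x(3) y(3) in \<open>simp add: power2_eq_square algebra_simps\<close>)
qed

lemma mixed_partials_eq:
  fixes f f1 f2 f12 f21 :: "real \<times> real \<Rightarrow> real"
  assumes f1: "\<And>x y. ((\<lambda>t. f (t, y)) has_real_derivative f1 (x, y)) (at x)"
    and f2: "\<And>x y. ((\<lambda>t. f (x, t)) has_real_derivative f2 (x, y)) (at y)"
    and f12: "\<And>x y. ((\<lambda>t. f1 (x, t)) has_real_derivative f12 (x, y)) (at y)"
    and f21: "\<And>x y. ((\<lambda>t. f2 (t, y)) has_real_derivative f21 (x, y)) (at x)"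
    and c12: "continuous_on UNIV f12" and c21: "continuous_on UNIV f21"
  shows "f12 z = f21 z"
proof -
  obtain a b where z: "z = (a, b)" by fastforce
  have "\<bar>f12 z - f21 z\<bar> \<le> 0 + e" if e: "0 < e" for e
  proof -
    obtain d1 where d1: "0 < d1" "\<And>u. dist u z < d1 \<Longrightarrow> dist (f12 u) (f12 z) < e / 2"
      using c12 e unfolding continuous_on_iff by (metis UNIV_I half_gt_zero)
    obtain d2 where d2: "0 < d2" "\<And>u. dist u z < d2 \<Longrightarrow> dist (f21 u) (f21 z) < e / 2"
      using c21 e unfolding continuous_on_iff by (metis UNIV_I half_gt_zero)
    define h where "h = min d1 d2 / 2"
    have h: "0 < h" using d1 d2 by (simp add: h_def)
    obtain x y where xy: "a < x" "x < a + h" "b < y" "y < b + h"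
      "f (a + h, b + h) - f (a + h, b) - f (a, b + h) + f (a, b) = h\<^sup>2 * f12 (x, y)"
      using mixed_difference_mean_value[of f f1 f12, OF f1 f12 h] by blast
    obtain y' x' where yx: "b < y'" "y' < b + h" "a < x'" "x' < a + h"
      "f (a + h, b + h) - f (a, b + h) - f (a + h, b) + f (a, b) = h\<^sup>2 * f21 (x', y')"
      using mixed_difference_mean_value[of "f \<circ> prod.swap" "f2 \<circ> prod.swap" "f21 \<circ> prod.swap" h b a] h f2 f21
      by auto
    have near: "dist (s, t) z < 2 * h" if "a < s" "s < a + h" "b < t" "t < b + h" for s t
    proof -
      have "dist (s, t) z \<le> \<bar>s - a\<bar> + \<bar>t - b\<bar>"
        unfolding z dist_Pair_Pair dist_real_def by (rule order_trans[OF sqrt_sum_squares_le_sum_abs]) simp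
      then show ?thesis using that by linarith
    qed
    have "dist (f12 (x, y)) (f12 z) < e / 2"
      by (rule d1(2)) (use near[OF xy(1-4)] in \<open>simp add: h_def\<close>)
    moreover have "dist (f21 (x', y')) (f21 z) < e / 2"
      by (rule d2(2)) (use near[OF yx(3,4,1,2)] in \<open>simp add: h_def\<close>)
    moreover have "h\<^sup>2 * f12 (x, y) = h\<^sup>2 * f21 (x', y')" using xy(5) yx(5) by linarith
    then have "f12 (x, y) = f21 (x', y')" using h by simp
    ultimately show ?thesis unfolding dist_real_def by linarith
  qed
  then have "\<bar>f12 z - f21 z\<bar> \<le> 0" by (rule field_le_epsilon)
  then show ?thesis by simp
qed

section \<open>Partial derivatives of planar fields\<close>

text \<open>Partial derivatives in \<open>real ^ 2\<close> become derivatives of functions of one real variable along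
  the coordinate lines, and integrals over squares become iterated integrals, in these coordinates.\<close>

definition pt :: "real \<times> real \<Rightarrow> real ^ 2" where
  "pt z = fst z *\<^sub>R axis 1 1 + snd z *\<^sub>R axis 2 1"

lemma pt_coordinates: "pt (x $ 1, x $ 2) = x"
  by (simp add: pt_def vec_eq_iff forall_2 axis_def)

lemma continuous_on_pt: "continuous_on UNIV g \<Longrightarrow> continuous_on UNIV (\<lambda>z. g (pt z))"
  unfolding pt_def
  by (rule continuous_on_compose2[of UNIV g]) (auto intro!: continuous_intros)

lemma DERIV_partial_1:
  fixes g :: "real ^ 2 \<Rightarrow> real"
  assumes "\<And>x. g differentiable (at x)"
  shows "((\<lambda>t. g (pt (t, y))) has_real_derivative partial_deriv 1 g (pt (x, y))) (at x)"
proof -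
  let ?G = "frechet_derivative g (at (pt (x, y)))"
  have G: "(g has_derivative ?G) (at (pt (x, y)))"
    using assms frechet_derivative_works by blast
  have "((\<lambda>t. pt (t, y)) has_derivative (\<lambda>h. h *\<^sub>R axis 1 1)) (at x)"
    unfolding pt_def by (auto intro!: derivative_eq_intros)
  from diff_chain_at[OF this G]
  have "((\<lambda>t. g (pt (t, y))) has_derivative (\<lambda>h. ?G (h *\<^sub>R axis 1 1))) (at x)"
    by (simp add: o_def)
  moreover have "?G (h *\<^sub>R axis 1 1) = partial_deriv 1 g (pt (x, y)) * h" for h
    using linear_scale[OF has_derivative_linear[OF G]] by (simp add: partial_deriv_def)
  ultimately show ?thesis by (simp add: has_field_derivative_def)
qed

lemma DERIV_partial_2:
  fixes g :: "real ^ 2 \<Rightarrow> real"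
  assumes "\<And>x. g differentiable (at x)"
  shows "((\<lambda>t. g (pt (x, t))) has_real_derivative partial_deriv 2 g (pt (x, y))) (at y)"
proof -
  let ?G = "frechet_derivative g (at (pt (x, y)))"
  have G: "(g has_derivative ?G) (at (pt (x, y)))"
    using assms frechet_derivative_works by blast
  have "((\<lambda>t. pt (x, t)) has_derivative (\<lambda>h. h *\<^sub>R axis 2 1)) (at y)"
    unfolding pt_def by (auto intro!: derivative_eq_intros)
  from diff_chain_at[OF this G]
  have "((\<lambda>t. g (pt (x, t))) has_derivative (\<lambda>h. ?G (h *\<^sub>R axis 2 1))) (at y)"
    by (simp add: o_def)
  moreover have "?G (h *\<^sub>R axis 2 1) = partial_deriv 2 g (pt (x, y)) * h" for h
    using linear_scale[OF has_derivative_linear[OF G]] by (simp add: partial_deriv_def)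
  ultimately show ?thesis by (simp add: has_field_derivative_def)
qed

lemma partial_deriv_component:
  fixes w :: "real ^ 'n \<Rightarrow> real ^ 'm"
  assumes "w differentiable (at x)"
  shows "partial_deriv i (\<lambda>x. w x $ j) x = partial_deriv i w x $ j"
proof -
  have "(w has_derivative frechet_derivative w (at x)) (at x)"
    using assms frechet_derivative_works by blast
  then have "((\<lambda>x. w x $ j) has_derivative (\<lambda>h. frechet_derivative w (at x) h $ j)) (at x)"
    by (rule bounded_linear.has_derivative[OF bounded_linear_vec_nth])
  then show ?thesis
    unfolding partial_deriv_def by (metis frechet_derivative_at)
qed

lemma partial_deriv_uminus:
  fixes g :: "real ^ 'n \<Rightarrow> real"
  assumes "g differentiable (at x)"
  shows "partial_deriv i (\<lambda>x. - g x) x = - partial_deriv i g x"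
proof -
  have "(g has_derivative frechet_derivative g (at x)) (at x)"
    using assms frechet_derivative_works by blast
  then have "((\<lambda>x. - g x) has_derivative (\<lambda>h. - frechet_derivative g (at x) h)) (at x)"
    by (rule has_derivative_minus)
  then show ?thesis
    unfolding partial_deriv_def by (metis frechet_derivative_at)
qed

lemma C_class_component:
  fixes w :: "real ^ 'n \<Rightarrow> real ^ 'm"
  shows "C_class k w \<Longrightarrow> C_class k (\<lambda>x. w x $ j)"
proof (induction k arbitrary: w)
  case 0
  then show ?case by (auto intro!: continuous_intros)
next
  case (Suc k)
  then have d: "w differentiable (at x)" for x by simp
  have "(\<lambda>x. w x $ j) differentiable (at x)" for x
    using d bounded_linear.has_derivative[OF bounded_linear_vec_nth] unfolding differentiable_def by blast
  moreover have "partial_deriv i (\<lambda>x. w x $ j) = (\<lambda>x. partial_deriv i w x $ j)" for i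
    using partial_deriv_component[OF d] by blast
  ultimately show ?case using Suc by simp
qed

lemma C_class_2D:
  assumes "C_class 2 g"
  shows "g differentiable (at x)" "partial_deriv i g differentiable (at x)"
    "continuous_on UNIV g" "continuous_on UNIV (partial_deriv i g)"
    "continuous_on UNIV (partial_deriv j (partial_deriv i g))"
proof -
  have d: "g differentiable (at x)" "partial_deriv i g differentiable (at x)" for i x
    using assms by (auto simp: numeral_2_eq_2)
  show "g differentiable (at x)" "partial_deriv i g differentiable (at x)" by (fact d)+
  show "continuous_on UNIV g" "continuous_on UNIV (partial_deriv i g)"
    using d by (auto intro!: continuous_at_imp_continuous_on differentiable_imp_continuous_within)
  show "continuous_on UNIV (partial_deriv j (partial_deriv i g))"
    using assms by (auto simp: numeral_2_eq_2)
qed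

section \<open>Euler flows\<close>

text \<open>With \<open>v = (a, b)\<close> and vorticity \<open>\<omega>\<close>, incompressibility gives \<open>\<Delta>a = - \<partial>\<^sub>2\<omega>\<close> and
  \<open>\<Delta>b = \<partial>\<^sub>1\<omega>\<close>, so the equation says \<open>v \<bullet> \<nabla>\<omega> = 0\<close>. It is stated with the
  Laplacians because this is the form in which it enters the equation for the slope of \<open>v\<close>.\<close>

lemma vorticity_transport:
  fixes v :: "real ^ 2 \<Rightarrow> real ^ 2"
  assumes C2: "C_class 2 v" and euler: "stationary_euler v p"
  defines "a \<equiv> \<lambda>x. v x $ 1" and "b \<equiv> \<lambda>x. v x $ 2"
  shows "a x * (partial_deriv 1 (partial_deriv 1 b) x + partial_deriv 2 (partial_deriv 2 b) x)
       = b x * (partial_deriv 1 (partial_deriv 1 a) x + partial_deriv 2 (partial_deriv 2 a) x)"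
proof -
  have ab: "v x $ 1 = a x" "v x $ 2 = b x" for x
    by (simp_all add: a_def b_def)
  have Ca: "C_class 2 a" and Cb: "C_class 2 b"
    using C2 C_class_component unfolding a_def b_def by blast+
  have v: "v differentiable (at x)" for x using C2 C_class_2D(1) by blast
  have p: "p differentiable (at x)" for x
    using euler by (simp add: stationary_euler_def)
  have pv: "partial_deriv i v x $ 1 = partial_deriv i a x"
    "partial_deriv i v x $ 2 = partial_deriv i b x" for i x
    using partial_deriv_component[OF v] unfolding a_def b_def by metis+
  have div: "partial_deriv 2 b x = - partial_deriv 1 a x" for x
    using euler unfolding stationary_euler_def divergence_def
    by (simp add: sum_2 pv add_eq_0_iff2)
  have mom: "convective v x $ i + gradient p x $ i = 0" for x i
    using euler unfolding stationary_euler_def by (metis vector_add_component zero_index)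
  have p1: "partial_deriv 1 p x = - (a x * partial_deriv 1 a x + b x * partial_deriv 2 a x)" for x
    using mom[of x 1] by (simp add: convective_def gradient_def sum_2 pv ab)
  have p2: "partial_deriv 2 p x = - (a x * partial_deriv 1 b x + b x * partial_deriv 2 b x)" for x
    using mom[of x 2] by (simp add: convective_def gradient_def sum_2 pv ab)
  \<comment> \<open>The mixed second derivatives of \<open>p\<close>, computed from the momentum equation.\<close>
  define q12 where "q12 x = - (partial_deriv 2 a x * partial_deriv 1 a x + a x * partial_deriv 2 (partial_deriv 1 a) x
     + (partial_deriv 2 b x * partial_deriv 2 a x + b x * partial_deriv 2 (partial_deriv 2 a) x))" for x
  define q21 where "q21 x = - (partial_deriv 1 a x * partial_deriv 1 b x + a x * partial_deriv 1 (partial_deriv 1 b) x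
     + (partial_deriv 1 b x * partial_deriv 2 b x + b x * partial_deriv 1 (partial_deriv 2 b) x))" for x
  have q: "q12 (pt z) = q21 (pt z)" for z
  proof (rule mixed_partials_eq[of "\<lambda>z. p (pt z)" "\<lambda>z. partial_deriv 1 p (pt z)" "\<lambda>z. partial_deriv 2 p (pt z)"])
    show "((\<lambda>t. p (pt (t, y))) has_real_derivative partial_deriv 1 p (pt (x, y))) (at x)"
      "((\<lambda>t. p (pt (x, t))) has_real_derivative partial_deriv 2 p (pt (x, y))) (at y)" for x y
      using DERIV_partial_1 DERIV_partial_2 p by blast+
    show "((\<lambda>t. partial_deriv 1 p (pt (x, t))) has_real_derivative q12 (pt (x, y))) (at y)" for x y
      unfolding p1 q12_def
      by (auto intro!: derivative_eq_intros DERIV_partial_2 C_class_2D[OF Ca] C_class_2D[OF Cb])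
    show "((\<lambda>t. partial_deriv 2 p (pt (t, y))) has_real_derivative q21 (pt (x, y))) (at x)" for x y
      unfolding p2 q21_def
      by (auto intro!: derivative_eq_intros DERIV_partial_1 C_class_2D[OF Ca] C_class_2D[OF Cb])
    show "continuous_on UNIV (\<lambda>z. q12 (pt z))" "continuous_on UNIV (\<lambda>z. q21 (pt z))"
      unfolding q12_def q21_def
      by (intro continuous_intros continuous_on_pt C_class_2D[OF Ca] C_class_2D[OF Cb])+
  qed
  \<comment> \<open>Differentiating the divergence condition directly supplies these mixed derivatives of \<open>v\<close> in
      the required order.\<close>
  have b2: "partial_deriv 2 b = (\<lambda>x. - partial_deriv 1 a x)" using div by blast
  have a1: "partial_deriv 1 a = (\<lambda>x. - partial_deriv 2 b x)" using div by simp
  have a12: "partial_deriv 2 (partial_deriv 1 a) x = - partial_deriv 2 (partial_deriv 2 b) x"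
    by (subst a1) (rule partial_deriv_uminus[OF C_class_2D(2)[OF Cb]])
  have b21: "partial_deriv 1 (partial_deriv 2 b) x = - partial_deriv 1 (partial_deriv 1 a) x"
    by (subst b2) (rule partial_deriv_uminus[OF C_class_2D(2)[OF Ca]])
  have "q12 x = q21 x" using q[of "(x $ 1, x $ 2)"] by (simp add: pt_coordinates)
  then show ?thesis
    unfolding q12_def q21_def a12 b21 div by (simp add: algebra_simps)
qed

text \<open>The direction of \<open>v\<close> is determined by the ratio of its components across and along \<open>e\<close>, and
  \<open>liouville_weighted\<close> with weight \<open>(v \<bullet> e)\<^sup>2\<close> makes this ratio constant.\<close>

lemma euler_flow_is_shear:
  fixes v :: "real ^ 2 \<Rightarrow> real ^ 2"
  assumes C2: "C_class 2 v" and euler: "stationary_euler v p"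
    and e: "norm e = 1"
    and along: "\<And>x. v x \<bullet> e \<noteq> 0"
    and across: "\<And>x. \<bar>v x \<bullet> vector [- e $ 2, e $ 1]\<bar> \<le> M"
  shows "shear_flow v"
proof -
  define a b where "a x = v x $ 1" and "b x = v x $ 2" for x
  have Ca: "C_class 2 a" and Cb: "C_class 2 b"
    using C_class_component[OF C2] unfolding a_def b_def by blast+
  note a = C_class_2D[OF Ca] and b = C_class_2D[OF Cb]
  have e2: "(e $ 1)\<^sup>2 + (e $ 2)\<^sup>2 = 1"
    using e by (simp add: norm_vec_def L2_set_def sum_2)
  define \<phi> where "\<phi> x = a x * e $ 1 + b x * e $ 2" for x
  define \<psi> where "\<psi> x = b x * e $ 1 - a x * e $ 2" for x
  have \<phi>: "\<phi> x \<noteq> 0" for x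
    using along[of x] by (simp add: \<phi>_def a_def b_def inner_vec_def sum_2)
  have \<psi>: "\<bar>\<psi> x\<bar> \<le> M" for x
    using across[of x] by (simp add: \<psi>_def a_def b_def inner_vec_def sum_2)
  \<comment> \<open>The flux \<open>\<phi> \<nabla>\<psi> - \<psi> \<nabla>\<phi>\<close>: this expression is invariant under rotations, so it can be
      written with the Cartesian components.\<close>
  define F where "F i x = a x * partial_deriv i b x - b x * partial_deriv i a x" for i x
  \<comment> \<open>The partial derivative of \<open>F i\<close> in direction \<open>i\<close>; the products of first derivatives
      cancel.\<close>
  define dF where "dF i x = a x * partial_deriv i (partial_deriv i b) x
    - b x * partial_deriv i (partial_deriv i a) x" for i x
  define s where "s z = \<psi> (pt z) / \<phi> (pt z)" for z
  have num: "(b' * e $ 1 - a' * e $ 2) * (A * e $ 1 + B * e $ 2) - (B * e $ 1 - A * e $ 2) * (a' * e $ 1 + b' * e $ 2)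
      = A * b' - B * a'" for a' b' A B :: real
  proof -
    have "(b' * e $ 1 - a' * e $ 2) * (A * e $ 1 + B * e $ 2) - (B * e $ 1 - A * e $ 2) * (a' * e $ 1 + b' * e $ 2)
      = (A * b' - B * a') * ((e $ 1)\<^sup>2 + (e $ 2)\<^sup>2)"
      by (simp add: power2_eq_square algebra_simps)
    then show ?thesis by (simp add: e2)
  qed
  have s1: "((\<lambda>t. s (t, y)) has_real_derivative F 1 (pt (x, y)) / (\<phi> (pt (x, y)))\<^sup>2) (at x)" for x y
  proof -
    note D = DERIV_partial_1[OF a(1), of y x] DERIV_partial_1[OF b(1), of y x]
    have 1: "((\<lambda>t. \<phi> (pt (t, y))) has_real_derivative
        partial_deriv 1 a (pt (x, y)) * e $ 1 + partial_deriv 1 b (pt (x, y)) * e $ 2) (at x)"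
      unfolding \<phi>_def by (auto intro!: derivative_eq_intros D)
    have 2: "((\<lambda>t. \<psi> (pt (t, y))) has_real_derivative
        partial_deriv 1 b (pt (x, y)) * e $ 1 - partial_deriv 1 a (pt (x, y)) * e $ 2) (at x)"
      unfolding \<psi>_def by (auto intro!: derivative_eq_intros D)
    show ?thesis
      unfolding s_def using DERIV_divide[OF 2 1 \<phi>]
      by (simp add: \<phi>_def \<psi>_def F_def num power2_eq_square)
  qed
  have s2: "((\<lambda>t. s (x, t)) has_real_derivative F 2 (pt (x, y)) / (\<phi> (pt (x, y)))\<^sup>2) (at y)" for x y
  proof -
    note D = DERIV_partial_2[OF a(1), of x y] DERIV_partial_2[OF b(1), of x y]
    have 1: "((\<lambda>t. \<phi> (pt (x, t))) has_real_derivative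
        partial_deriv 2 a (pt (x, y)) * e $ 1 + partial_deriv 2 b (pt (x, y)) * e $ 2) (at y)"
      unfolding \<phi>_def by (auto intro!: derivative_eq_intros D)
    have 2: "((\<lambda>t. \<psi> (pt (x, t))) has_real_derivative
        partial_deriv 2 b (pt (x, y)) * e $ 1 - partial_deriv 2 a (pt (x, y)) * e $ 2) (at y)"
      unfolding \<psi>_def by (auto intro!: derivative_eq_intros D)
    show ?thesis
      unfolding s_def using DERIV_divide[OF 2 1 \<phi>]
      by (simp add: \<phi>_def \<psi>_def F_def num power2_eq_square)
  qed
  have c\<phi>: "continuous_on UNIV \<phi>" and c\<psi>: "continuous_on UNIV \<psi>"
    unfolding \<phi>_def \<psi>_def by (intro continuous_intros a b)+
  have cF: "continuous_on UNIV (F i)" "continuous_on UNIV (dF i)" for i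
    unfolding F_def dF_def by (intro continuous_intros a b)+
  have flat: "(\<phi> (pt z))\<^sup>2 * ((F 1 (pt z) / (\<phi> (pt z))\<^sup>2)\<^sup>2 + (F 2 (pt z) / (\<phi> (pt z))\<^sup>2)\<^sup>2) = 0" for z
  proof (rule liouville_weighted[where s = s and w = "\<lambda>z. (\<phi> (pt z))\<^sup>2" and K = "M\<^sup>2"
      and ?s1.0 = "\<lambda>z. F 1 (pt z) / (\<phi> (pt z))\<^sup>2" and ?s2.0 = "\<lambda>z. F 2 (pt z) / (\<phi> (pt z))\<^sup>2"
      and ?d1.0 = "\<lambda>z. dF 1 (pt z)" and ?d2.0 = "\<lambda>z. dF 2 (pt z)"])
    show "((\<lambda>t. (\<phi> (pt (t, y)))\<^sup>2 * (F 1 (pt (t, y)) / (\<phi> (pt (t, y)))\<^sup>2)) has_real_derivative dF 1 (pt (x, y))) (at x)" for x y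
    proof -
      have "((\<lambda>t. F 1 (pt (t, y))) has_real_derivative dF 1 (pt (x, y))) (at x)"
        unfolding F_def dF_def by (auto intro!: derivative_eq_intros DERIV_partial_1 a b)
      then show ?thesis by (simp add: \<phi>)
    qed
    show "((\<lambda>t. (\<phi> (pt (x, t)))\<^sup>2 * (F 2 (pt (x, t)) / (\<phi> (pt (x, t)))\<^sup>2)) has_real_derivative dF 2 (pt (x, y))) (at y)" for x y
    proof -
      have "((\<lambda>t. F 2 (pt (x, t))) has_real_derivative dF 2 (pt (x, y))) (at y)"
        unfolding F_def dF_def by (auto intro!: derivative_eq_intros DERIV_partial_2 a b)
      then show ?thesis by (simp add: \<phi>)
    qed
    show "dF 1 (pt z) + dF 2 (pt z) = 0" for z
      using vorticity_transport[OF C2 euler, of "pt z", folded a_def b_def]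
      by (simp add: dF_def algebra_simps)
    show "(\<phi> (pt z))\<^sup>2 * (s z)\<^sup>2 \<le> M\<^sup>2" for z
      using \<psi>[of "pt z"] \<phi> by (simp add: s_def power_divide abs_le_square_iff[symmetric])
  qed (auto simp: s_def \<phi> intro!: s1[unfolded s_def] s2[unfolded s_def] continuous_intros continuous_on_pt c\<phi> c\<psi> cF)
  have F0: "F 1 (pt z) = 0 \<and> F 2 (pt z) = 0" for z
    using flat[of z] \<phi> by (simp add: sum_power2_eq_zero_iff)
  define k where "k = s (0, 0)"
  have "s (x, y) = k" for x y
  proof -
    have "s (x, y) = s (0, y)"
      by (rule DERIV_isconst_all[of "\<lambda>t. s (t, y)"]) (use s1[of y] F0 in simp)
    also have "\<dots> = s (0, 0)"
      by (rule DERIV_isconst_all[of "\<lambda>t. s (0, t)"]) (use s2[of 0] F0 in simp)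
    finally show ?thesis by (simp add: k_def)
  qed
  then have \<psi>k: "\<psi> x = k * \<phi> x" for x
    using \<phi>[of x] unfolding s_def by (metis pt_coordinates nonzero_eq_divide_eq)
  define u :: "real ^ 2" where "u = vector [e $ 1 - k * e $ 2, e $ 2 + k * e $ 1]"
  have v: "v x = \<phi> x *\<^sub>R u" for x
  proof -
    have "a x = \<phi> x * e $ 1 - \<psi> x * e $ 2" "b x = \<phi> x * e $ 2 + \<psi> x * e $ 1"
      using e2 unfolding \<phi>_def \<psi>_def by algebra+
    then show ?thesis
      by (simp add: u_def vec_eq_iff forall_2 \<psi>k a_def b_def algebra_simps)
  qed
  have u: "u \<noteq> 0" using v[of 0] along[of 0] by auto
  have "v x = (\<phi> x * norm u) *\<^sub>R (u /\<^sub>R norm u)" for x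
    using u by (simp add: v)
  moreover have "norm (u /\<^sub>R norm u) = 1" using u by simp
  ultimately show ?thesis unfolding shear_flow_def by blast
qed

section \<open>Stability of shear flows\<close>

text \<open>The set where \<open>norm (f x) \<le> \<epsilon>\<close> is closed and has full measure, hence it is the whole plane.\<close>

lemma Linf_norm_le_pointwise:
  assumes cont: "continuous_on UNIV f" and le: "Linf_norm f \<le> ereal \<epsilon>"
  shows "norm (f x) \<le> \<epsilon>"
proof -
  have "AE x in lebesgue. ereal (norm (f x)) \<le> Linf_norm f"
    unfolding Linf_norm_def by (rule esssup_AE)
  then have "AE x in lebesgue. x \<in> {x. norm (f x) \<le> \<epsilon>}"
    using le by (auto elim!: eventually_mono dest: order_trans)
  moreover have "closed {x. norm (f x) \<le> \<epsilon>}"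
    by (intro closed_Collect_le continuous_intros cont)
  ultimately show ?thesis using mem_closed_if_AE_lebesgue by blast
qed

theorem corollary1p3:
  fixes v :: "real ^ 2 \<Rightarrow> real ^ 2"
  assumes "shear_flow v"
    and "\<exists>p. stationary_euler v p"
    and "bounded (range v)"
    and "(INF x. norm (v x)) > 0"
  shows "\<exists>\<epsilon>>0. \<forall>v' :: real ^ 2 \<Rightarrow> real ^ 2.
           C_class 2 v' \<and> (\<exists>p'. stationary_euler v' p') \<and>
           Linf_norm (\<lambda>x. v' x - v x) \<le> ereal \<epsilon> \<longrightarrow> shear_flow v'"
proof -
  define m where "m = (INF x. norm (v x))"
  have m: "0 < m" using assms(4) by (simp add: m_def)
  have vm: "m \<le> norm (v x)" for x
    unfolding m_def by (rule cINF_lower) (auto intro!: bdd_belowI[of _ 0])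
  obtain e where e: "norm e = 1" and par: "\<And>x. \<exists>c. v x = c *\<^sub>R e"
    using assms(1) unfolding shear_flow_def by blast
  let ?n = "vector [- e $ 2, e $ 1] :: real ^ 2"
  have n: "norm ?n = 1" "e \<bullet> ?n = 0"
    using e by (simp_all add: norm_vec_def L2_set_def sum_2 inner_vec_def add.commute)
  have cv: "continuous_on UNIV v"
    using assms(2) by (auto simp: stationary_euler_def
        intro!: continuous_at_imp_continuous_on differentiable_imp_continuous_within)
  have "shear_flow v'" if C2: "C_class 2 v'" and euler: "stationary_euler v' p'"
    and close: "Linf_norm (\<lambda>x. v' x - v x) \<le> ereal (m / 2)" for v' p'
  proof -
    have d: "norm (v' x - v x) \<le> m / 2" for x
      by (rule Linf_norm_le_pointwise[OF _ close]) (intro continuous_intros cv C_class_2D(3)[OF C2])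
    show ?thesis
    proof (rule euler_flow_is_shear[OF C2 euler e])
      fix x
      obtain c where c: "v x = c *\<^sub>R e" using par by blast
      have split: "v' x \<bullet> y = v x \<bullet> y + (v' x - v x) \<bullet> y" for y
        by (simp add: inner_diff_left)
      have small: "\<bar>(v' x - v x) \<bullet> y\<bar> \<le> m / 2" if "norm y = 1" for y
        using Cauchy_Schwarz_ineq2[of "v' x - v x" y] d[of x] that by simp
      have "\<bar>v x \<bullet> e\<bar> = norm (v x)" using e by (simp add: c dot_square_norm)
      then show "v' x \<bullet> e \<noteq> 0"
        using split[of e] small[OF e] vm[of x] m by linarith
      show "\<bar>v' x \<bullet> ?n\<bar> \<le> m / 2"
        using split[of ?n] small[OF n(1)] n(2) by (simp add: c)
    qed
  qed
  then show ?thesis using m by (intro exI[of _ "m / 2"]) auto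
qed

end
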